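(* The space $\mathrm{GST}_4=\mathrm{Ind}_4\cap\mathrm{Inf}_4\subset[0,1]^4$ (with the subspace topology from $\mathbb{R}^4$) has exactly two connected components.
   Context: Let $n\ge 3$ (here $n=4$). A symmetric $n$-player game with $n$ dichotomous causes $C_1,\dots,C_n$ (each of probability $1/2$) and $n$ dichotomous effects $E_1,\dots,E_n$ is encoded by a point $\mathbf{x}=(x_1,\dots,x_n)\in[0,1]^n$, where $x_s$ is the probability of the effect for a player when exactly $s$ players (including that player) have the same cause state as that player. Define $$\Psi(\mathbf{x})=\left(\frac{1}{2^{n-1}}\sum_{k=0}^{n-1}\binom{n-1}{k}x_{k+1}\right)^2-\frac{1}{2^{n-1}}\sum_{k=0}^{n-2}\binom{n-2}{k}\left(x_{k+2}^2+x_{k+1}x_{n-(k+1)}\right).$$ The independence space is $\mathrm{Ind}_n=\{\mathbf{x}\in[0,1]^n : \Psi(\mathbf{x})=0\}$ (this expresses $\mathbb{P}(E_i\wedge E_j\mid C_k)=\mathbb{P}(E_i\mid C_k)\mathbb{P}(E_j\mid C_k)$). The influence space is $\mathrm{Inf}_n=\{\mathbf{x}\in[0,1]^n : \text{there exists } s\in\{1,\dots,n\} \text{ with } x_s\ne x_{n-s+1}\}$ (this expresses that every cause influences every effect). Finally, $\mathrm{GST}_n=\mathrm{Ind}_n\cap\mathrm{Inf}_n$. *)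

theory Defs
  imports "HOL-Analysis.Analysis"
begin

text \<open>
  The dimension is \<open>n = CARD('n)\<close>, where \<open>'n\<close> is meant to be a numeral type such as \<open>4\<close>.
  The coordinate \<open>x\<^sub>s\<close> for \<open>1 \<le> s \<le> n\<close> is \<open>x $ of_nat s\<close>: a numeral type is the ring of
  integers modulo \<open>n\<close>, so \<open>of_nat\<close> maps \<open>{1..n}\<close> bijectively onto it (with \<open>of_nat n = 0\<close>).
\<close>

definition coord :: "real ^ 'n :: {finite, comm_ring_1} \<Rightarrow> nat \<Rightarrow> real" where
  "coord x s = x $ of_nat s"

definition Psi :: "nat \<Rightarrow> (nat \<Rightarrow> real) \<Rightarrow> real" where
  "Psi n x =
     (1 / 2 ^ (n - 1) * (\<Sum>k = 0..n - 1. real ((n - 1) choose k) * x (k + 1)))\<^sup>2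
     - 1 / 2 ^ (n - 1) *
         (\<Sum>k = 0..n - 2. real ((n - 2) choose k) * ((x (k + 2))\<^sup>2 + x (k + 1) * x (n - (k + 1))))"

definition unit_cube :: "(real ^ 'n) set" where
  "unit_cube = {x. \<forall>i. x $ i \<in> {0..1}}"

definition Ind_space :: "(real ^ 'n :: {finite, comm_ring_1}) set" where
  "Ind_space = {x \<in> unit_cube. Psi CARD('n) (coord x) = 0}"

definition Inf_space :: "(real ^ 'n :: {finite, comm_ring_1}) set" where
  "Inf_space = {x \<in> unit_cube. \<exists>s \<in> {1..CARD('n)}. coord x s \<noteq> coord x (CARD('n) - s + 1)}"

definition GST :: "(real ^ 'n :: {finite, comm_ring_1}) set" where
  "GST = Ind_space \<inter> Inf_space"

end

theory Submission
  imports Defs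
begin

text \<open>
  For \<open>n = 4\<close>, the equation \<open>Psi = 0\<close> reads \<open>S\<^sup>2 = 24 (x\<^sub>2 - x\<^sub>3)\<^sup>2 + 8 (x\<^sub>3 - x\<^sub>4)\<^sup>2\<close> with the linear
  form \<open>S = x\<^sub>1 + 3 x\<^sub>2 - 5 x\<^sub>3 + x\<^sub>4\<close>: an elliptic double cone times the line spanned by
  \<open>(1,1,1,1)\<close>. The points of this set excluded by \<open>Inf_space\<close> are exactly those on the line, so
  \<open>S\<close> does not vanish on \<open>GST\<close>. Each of the two pieces \<open>S > 0\<close> and \<open>S < 0\<close> is connected: if
  \<open>v(\<theta>)\<close> runs through the ellipse \<open>S = 1\<close>, \<open>x\<^sub>4 = 0\<close> of the cone, a point \<open>t (1,1,1,1) + r v(\<theta>)\<close> is joined inside the cube by a straight segment to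
  \<open>(1/2) (1,1,1,1) \<plusminus> (1/6) v(\<theta>)\<close>, and the latter points form a closed curve. Coordinate \<open>x\<^sub>4\<close> has index \<open>0\<close> in the type \<open>4\<close>.
\<close>

text \<open>By the intermediate value property \<open>f\<close> has constant sign on every connected
  subset of \<open>X\<close>, so a connected set containing one of the two sign pieces cannot be
  larger than it.\<close>

lemma card_components_eq_2_if_sign:
  fixes f :: "'a :: topological_space \<Rightarrow> real"
  assumes cont: "continuous_on X f" and nz: "\<And>x. x \<in> X \<Longrightarrow> f x \<noteq> 0"
    and conn: "connected {x \<in> X. f x > 0}" "connected {x \<in> X. f x < 0}"
    and ne: "{x \<in> X. f x > 0} \<noteq> {}" "{x \<in> X. f x < 0} \<noteq> {}"
  shows "card (components X) = 2"
proof -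
  let ?P = "{x \<in> X. f x > 0}" and ?N = "{x \<in> X. f x < 0}"
  have same_sign: "f x > 0 \<longleftrightarrow> f y > 0" if "connected D" "D \<subseteq> X" "x \<in> D" "y \<in> D" for D x y
  proof (rule ccontr)
    assume neq: "(f x > 0) \<noteq> (f y > 0)"
    have "connected (f ` D)"
      using that cont connected_continuous_image continuous_on_subset by blast
    moreover have "f x < 0 \<and> 0 < f y \<or> f y < 0 \<and> 0 < f x"
      using neq nz that by (metis linorder_neqE_linordered_idom subsetD)
    ultimately have "0 \<in> f ` D"
      using that by (meson connectedD_interval imageI less_imp_le)
    then show False using nz that by auto
  qed
  have P: "?P \<in> components X"
    unfolding in_components_maximal
  proof (intro conjI allI impI)
    fix D assume D: "D \<noteq> {} \<and> ?P \<subseteq> D \<and> D \<subseteq> X \<and> connected D"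
    with ne(1) obtain x where "x \<in> D" "f x > 0" by blast
    with D show "D = ?P" using same_sign[of D x] by blast
  qed (use ne conn in auto)
  have N: "?N \<in> components X"
    unfolding in_components_maximal
  proof (intro conjI allI impI)
    fix D assume D: "D \<noteq> {} \<and> ?N \<subseteq> D \<and> D \<subseteq> X \<and> connected D"
    with ne(2) obtain x where x: "x \<in> D" "f x < 0" by blast
    \<comment> \<open>\<open>same_sign\<close> only excludes \<open>f y > 0\<close>; the value 0 is
      excluded by \<open>nz\<close>.\<close>
    have "f y < 0" if "y \<in> D" for y
      using D x that same_sign[of D x y] nz[of y] by (auto simp: not_less_iff_gr_or_eq)
    with D show "D = ?N" by blast
  qed (use ne conn in auto)
  have "components X \<subseteq> {?P, ?N}"
  proof
    fix C assume C: "C \<in> components X"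
    then obtain x where x: "x \<in> C" "x \<in> X"
      using in_components_nonempty in_components_subset by blast
    then have "x \<in> ?P \<or> x \<in> ?N" using nz[of x] by auto
    then show "C \<in> {?P, ?N}"
      using x C P N components_nonoverlap[of C X] by blast
  qed
  with P N have "components X = {?P, ?N}" by blast
  moreover have "?P \<noteq> ?N" using ne(1) by force
  ultimately show ?thesis by simp
qed

lemma four_eq_0: "(4::4) = 0"
  by simp

lemma forall_index4: "(\<forall>i::4. P i) \<longleftrightarrow> P 1 \<and> P 2 \<and> P 3 \<and> P 0"
  using forall_4[of P] by (simp add: four_eq_0)

definition axis_form :: "real ^ 4 \<Rightarrow> real" where
  "axis_form x = x $ 1 + 3 * x $ 2 - 5 * x $ 3 + x $ 0"

text \<open>Completing the square in \<open>x $ 1\<close>: absorbing the cross term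
  \<open>-16 * x $ 1 * x $ 3\<close> turns the coefficient 3 of \<open>x $ 3\<close> in the mean
  into -5, and what remains is free of \<open>x $ 1\<close>. The factor 64 clears
  denominators.\<close>

lemma Psi_4:
  "64 * Psi 4 (coord (x :: real ^ 4)) =
     (axis_form x)\<^sup>2 - 24 * (x $ 2 - x $ 3)\<^sup>2 - 8 * (x $ 3 - x $ 0)\<^sup>2"
proof -
  have "{0..3::nat} = {0,1,2,3}" "{0..2::nat} = {0,1,2}" by auto
  then show ?thesis
    by (simp add: Psi_def coord_def axis_form_def power2_eq_square field_simps
        numeral_3_eq_3 numeral_2_eq_2 four_eq_0)
qed

lemma GST_4_iff:
  fixes x :: "real ^ 4"
  shows "x \<in> GST \<longleftrightarrow> x \<in> unit_cube \<and> axis_form x \<noteq> 0 \<and>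
    (axis_form x)\<^sup>2 = 24 * (x $ 2 - x $ 3)\<^sup>2 + 8 * (x $ 3 - x $ 0)\<^sup>2"
proof -
  have "{1..4::nat} = {1,2,3,4}" by auto
  then have inf: "x \<in> Inf_space \<longleftrightarrow> x \<in> unit_cube \<and> (x $ 1 \<noteq> x $ 0 \<or> x $ 2 \<noteq> x $ 3)"
    by (auto simp: Inf_space_def coord_def four_eq_0)
  have ind: "x \<in> Ind_space \<longleftrightarrow> x \<in> unit_cube \<and>
      (axis_form x)\<^sup>2 = 24 * (x $ 2 - x $ 3)\<^sup>2 + 8 * (x $ 3 - x $ 0)\<^sup>2"
    using Psi_4[of x] by (auto simp: Ind_space_def)
  have "x $ 1 = x $ 0 \<and> x $ 2 = x $ 3 \<longleftrightarrow> axis_form x = 0"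
    if eq: "(axis_form x)\<^sup>2 = 24 * (x $ 2 - x $ 3)\<^sup>2 + 8 * (x $ 3 - x $ 0)\<^sup>2"
  proof
    assume h: "x $ 1 = x $ 0 \<and> x $ 2 = x $ 3"
    then have S: "axis_form x = - 2 * (x $ 3 - x $ 0)" by (simp add: axis_form_def)
    \<comment> \<open>With \<open>d = x $ 3 - x $ 0\<close> the equation reads
      \<open>4 * d\<^sup>2 = 8 * d\<^sup>2\<close>.\<close>
    have "(x $ 3 - x $ 0)\<^sup>2 = 0" using eq h unfolding S power_mult_distrib by simp
    then show "axis_form x = 0" by (simp add: S)
  next
    assume S: "axis_form x = 0"
    have "(x $ 2 - x $ 3)\<^sup>2 = 0" "(x $ 3 - x $ 0)\<^sup>2 = 0"
      using eq zero_le_power2[of "x $ 2 - x $ 3"] zero_le_power2[of "x $ 3 - x $ 0"]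
      unfolding S zero_power2 by linarith+
    then show "x $ 1 = x $ 0 \<and> x $ 2 = x $ 3" using S by (simp add: axis_form_def)
  qed
  then show ?thesis using inf ind by (auto simp: GST_def)
qed

text \<open>The angle parametrizes the ellipse through \<open>x $ 2 - x $ 3\<close> and
  \<open>x $ 3 - x $ 0\<close>; coordinate 1 is then forced by the requirement that
  \<open>axis_form\<close> equal \<open>r\<close>. The last branch is index 0.\<close>

definition cone_point :: "real \<Rightarrow> real \<Rightarrow> real \<Rightarrow> real ^ 4" where
  "cone_point t r \<theta> = (\<chi> i.
     if i = 1 then t + r * (1 - 3 * (sin \<theta> / sqrt 24) + 2 * (cos \<theta> / sqrt 8))
     else if i = 2 then t + r * (sin \<theta> / sqrt 24 + cos \<theta> / sqrt 8)
     else if i = 3 then t + r * (cos \<theta> / sqrt 8)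
     else t)"

lemma cone_point_nth:
  "cone_point t r \<theta> $ 1 = t + r * (1 - 3 * (sin \<theta> / sqrt 24) + 2 * (cos \<theta> / sqrt 8))"
  "cone_point t r \<theta> $ 2 = t + r * (sin \<theta> / sqrt 24 + cos \<theta> / sqrt 8)"
  "cone_point t r \<theta> $ 3 = t + r * (cos \<theta> / sqrt 8)"
  "cone_point t r \<theta> $ 0 = t"
  by (simp_all add: cone_point_def)

lemma axis_form_cone_point: "axis_form (cone_point t r \<theta>) = r"
  by (simp add: axis_form_def cone_point_nth algebra_simps)

lemma cone_point_in_GST:
  assumes "cone_point t r \<theta> \<in> unit_cube" "r \<noteq> 0"
  shows "cone_point t r \<theta> \<in> GST"
proof -
  have "24 * (r * (sin \<theta> / sqrt 24))\<^sup>2 + 8 * (r * (cos \<theta> / sqrt 8))\<^sup>2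
      = r\<^sup>2 * ((sin \<theta>)\<^sup>2 + (cos \<theta>)\<^sup>2)"
    by (simp add: power_mult_distrib power_divide distrib_left del: sin_cos_squared_add)
  then show ?thesis
    using assms unfolding GST_4_iff axis_form_cone_point
    by (simp add: cone_point_nth algebra_simps)
qed

text \<open>Divided by the nonzero \<open>axis_form x\<close> and rescaled, the two differences form
  a point of the unit circle, which supplies the angle.\<close>

lemma GST_4_cone_pointE:
  assumes "x \<in> (GST :: (real ^ 4) set)"
  obtains t \<theta> where "x = cone_point t (axis_form x) \<theta>"
proof -
  define r where "r = axis_form x"
  have r: "r \<noteq> 0" and eq: "r\<^sup>2 = 24 * (x $ 2 - x $ 3)\<^sup>2 + 8 * (x $ 3 - x $ 0)\<^sup>2"
    using assms by (auto simp: GST_4_iff r_def)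
  have "(sqrt 8 * (x $ 3 - x $ 0) / r)\<^sup>2 + (sqrt 24 * (x $ 2 - x $ 3) / r)\<^sup>2 = r\<^sup>2 / r\<^sup>2"
    by (simp only: eq[symmetric] power_divide flip: add_divide_distrib) (simp add: power_mult_distrib eq)
  also have "\<dots> = 1" using r by simp
  finally obtain \<theta> where "sqrt 8 * (x $ 3 - x $ 0) / r = cos \<theta>" "sqrt 24 * (x $ 2 - x $ 3) / r = sin \<theta>"
    using sincos_total_2pi by metis
  then have "x $ 3 - x $ 0 = r * (cos \<theta> / sqrt 8)" "x $ 2 - x $ 3 = r * (sin \<theta> / sqrt 24)"
    using r by (simp_all add: field_simps)
  moreover have "r = x $ 1 + 3 * x $ 2 - 5 * x $ 3 + x $ 0"
    by (simp add: r_def axis_form_def)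
  ultimately have "x = cone_point (x $ 0) r \<theta>"
    unfolding vec_eq_iff forall_index4 cone_point_nth 
    by (simp add: distrib_left right_diff_distrib mult.left_commute[of r] del: times_divide_eq_right)
  then show ?thesis using that r_def by blast
qed

text \<open>Whatever the angle, no coordinate is further than \<open>3 * \<bar>r\<bar>\<close> from
  the centre \<open>1/2\<close>; hence the radius \<open>1/6\<close>.\<close>

lemma cone_point_half_in_unit_cube:
  assumes "\<bar>r\<bar> \<le> 1/6"
  shows "cone_point (1/2) r \<theta> \<in> unit_cube"
proof -
  define p where "p = sin \<theta> / sqrt 24"
  define q where "q = cos \<theta> / sqrt 8"
  have "sqrt 24 \<ge> 4" "sqrt 8 \<ge> 2"
    by (simp_all add: real_le_rsqrt)
  then have "\<bar>sin \<theta>\<bar> * 4 \<le> sqrt 24" "\<bar>cos \<theta>\<bar> * 2 \<le> sqrt 8"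
    using abs_sin_le_one[of \<theta>] abs_cos_le_one[of \<theta>] by linarith+
  then have "\<bar>p\<bar> \<le> 1/4" "\<bar>q\<bar> \<le> 1/2"
    by (simp_all add: p_def q_def pos_divide_le_eq)
  \<comment> \<open>The largest of the three is bounded by \<open>1 + 3/4 + 1 < 3\<close>.\<close>
  then have "\<bar>1 - 3 * p + 2 * q\<bar> \<le> 3" "\<bar>p + q\<bar> \<le> 3" "\<bar>q\<bar> \<le> 3"
    by linarith+
  moreover have "\<bar>r * v\<bar> \<le> 1/2" if "\<bar>v\<bar> \<le> 3" for v
    using mult_mono[OF assms that] by (simp add: abs_mult)
  ultimately have "\<bar>r * (1 - 3 * p + 2 * q)\<bar> \<le> 1/2" "\<bar>r * (p + q)\<bar> \<le> 1/2" "\<bar>r * q\<bar> \<le> 1/2"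
    by blast+
  then show ?thesis
    unfolding unit_cube_def mem_Collect_eq forall_index4 cone_point_nth
      p_def[symmetric] q_def[symmetric] atLeastAtMost_iff abs_le_iff
    by linarith
qed

lemma convex_unit_cube: "convex (unit_cube :: (real ^ 'n) set)"
  unfolding unit_cube_def convex_alt by (auto intro: convex_bound_le)

text \<open>For a fixed angle the point depends linearly on \<open>t\<close> and \<open>r\<close>,
  so segments between points of equal angle stay on the cone.\<close>

lemma cone_point_combine:
  "(1 - u) *\<^sub>R cone_point t r \<theta> + u *\<^sub>R cone_point t' r' \<theta> =
     cone_point ((1 - u) * t + u * t') ((1 - u) * r + u * r') \<theta>"
  unfolding vec_eq_iff forall_index4 by (simp add: cone_point_nth algebra_simps add_divide_distrib diff_divide_distrib)

lemma continuous_on_cone_point: "continuous_on A (cone_point t r)"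
  unfolding cone_point_def
proof (rule continuous_on_vec_lambda)
  show "continuous_on A (\<lambda>\<theta>.
     if i = 1 then t + r * (1 - 3 * (sin \<theta> / sqrt 24) + 2 * (cos \<theta> / sqrt 8))
     else if i = 2 then t + r * (sin \<theta> / sqrt 24 + cos \<theta> / sqrt 8)
     else if i = 3 then t + r * (cos \<theta> / sqrt 8)
     else t)" for i :: 4
    by (cases "i = 1"; cases "i = 2"; cases "i = 3"; simp; intro continuous_intros; simp)
qed

text \<open>The sign \<open>s\<close> treats both halves of the cone at once.\<close>

lemma connected_GST_half:
  assumes "\<bar>s\<bar> = (1 :: real)"
  shows "connected {x \<in> (GST :: (real ^ 4) set). s * axis_form x > 0}" (is "connected ?H")
proof -
  let ?c = "cone_point (1/2) (s / 6)"
  have ss: "s * s = 1" using assms by (metis abs_mult_self_eq mult_1)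
  have c_cube: "?c \<theta> \<in> unit_cube" for \<theta>
    by (rule cone_point_half_in_unit_cube) (use assms in auto)
  have H_I: "cone_point t r \<theta> \<in> ?H" if "cone_point t r \<theta> \<in> unit_cube" "s * r > 0" for t r \<theta>
    using that cone_point_in_GST[of t r \<theta>] by (cases "r = 0") (simp_all add: axis_form_cone_point)
  have ellipse: "range ?c \<subseteq> ?H"
    using H_I[OF c_cube] ss by auto
  have "connected (range ?c)"
    by (rule connected_continuous_image[OF continuous_on_cone_point]) simp
  then have ellipse_conn: "connected_component ?H (?c \<theta>) (?c \<theta>')" for \<theta> \<theta>'
    using ellipse unfolding connected_component_def by blast
  have to_ellipse: "\<exists>\<theta>. connected_component ?H x (?c \<theta>)" if x: "x \<in> ?H" for x
  proof -
    from x obtain t r \<theta> where xt: "x = cone_point t r \<theta>"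
      using GST_4_cone_pointE by blast
    have r: "s * r > 0" using x by (simp add: xt axis_form_cone_point)
    \<comment> \<open>The target on the ellipse has the same angle as \<open>x\<close>. Convexity
      keeps the segment in the cube, and \<open>s * axis_form\<close> stays positive along it,
      interpolating between \<open>s * r\<close> and \<open>1/6\<close>.\<close>
    have "closed_segment x (?c \<theta>) \<subseteq> ?H"
    proof
      fix y assume y: "y \<in> closed_segment x (?c \<theta>)"
      then obtain u where u: "0 \<le> u" "u \<le> 1" "y = (1 - u) *\<^sub>R x + u *\<^sub>R ?c \<theta>"
        by (auto simp: in_segment)
      then have y_eq: "y = cone_point ((1 - u) * t + u * (1/2)) ((1 - u) * r + u * (s / 6)) \<theta>"
        by (simp only: xt cone_point_combine)
      have "y \<in> unit_cube"
        using y x c_cube[of \<theta>] closed_segment_subset[OF _ _ convex_unit_cube, of x "?c \<theta>"]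
        by (auto simp: GST_4_iff)
      moreover have "s * ((1 - u) * r + u * (s / 6)) = (1 - u) * (s * r) + u * (1 / 6)"
        using ss by (simp add: algebra_simps)
      moreover have "(1 - u) * (s * r) + u * (1 / 6) > 0"
        using r u by (cases "u = 1") (auto intro: add_pos_nonneg)
      ultimately show "y \<in> ?H"
        unfolding y_eq by (intro H_I) simp_all
    qed
    then have "connected_component ?H x (?c \<theta>)"
      using connected_component_of_subset connected_component_def connected_segment(1)
        ends_in_segment by blast
    then show ?thesis ..
  qed
  show ?thesis
    unfolding connected_iff_connected_component
  proof (intro ballI)
    fix x y assume "x \<in> ?H" "y \<in> ?H"
    then obtain \<theta> \<theta>' where "connected_component ?H x (?c \<theta>)" "connected_component ?H y (?c \<theta>')"
      using to_ellipse by blast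
    then show "connected_component ?H x y"
      by (rule connected_component_trans
          [OF connected_component_trans[OF _ ellipse_conn] connected_component_sym])
  qed
qed

theorem mainTheorem2:
  shows "card (components (GST :: (real ^ 4) set)) = 2"
proof (rule card_components_eq_2_if_sign[where f = axis_form])
  show "continuous_on GST axis_form"
    unfolding axis_form_def by (intro continuous_intros)
  show "axis_form x \<noteq> 0" if "x \<in> GST" for x
    using that GST_4_iff by blast
  show "connected {x \<in> GST. axis_form x > 0}" "connected {x \<in> GST. axis_form x < 0}"
    using connected_GST_half[of 1] connected_GST_half[of "- 1"] by auto
  \<comment> \<open>The angle 0 is arbitrary; the two signs of \<open>r\<close> give a point in each
    half.\<close>
  have "cone_point (1/2) r 0 \<in> GST" if "\<bar>r\<bar> = 1/6" for r
    using that by (auto intro!: cone_point_in_GST cone_point_half_in_unit_cube)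
  from this[of "1/6"] this[of "- (1/6)"]
  show "{x \<in> (GST :: (real ^ 4) set). axis_form x > 0} \<noteq> {}"
    "{x \<in> (GST :: (real ^ 4) set). axis_form x < 0} \<noteq> {}"
    using axis_form_cone_point by force+
qed

end
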